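(* Let $L_0$ be a closed densely defined symmetric positive definite operator with nonzero defect indexes in a separable Hilbert space $\mathcal H$, for which the wave spectrum $\Omega_{L_0}$ is defined (bounded case). Let $U:\mathcal H\to\widetilde{\mathcal H}$ be a unitary operator onto a Hilbert space $\widetilde{\mathcal H}$ and $\widetilde L_0=UL_0U^*$. Then the wave spectra $\Omega_{L_0}$ and $\Omega_{\widetilde L_0}$ are isometric as metric spaces.
   Context: **Algebras with space extension.** Let $\mathcal H$ be a separable Hilbert space, $\mathrm{Lat}\,\mathcal H$ the lattice of its closed subspaces, $\mathfrak B(\mathcal H)$ the algebra of bounded operators, $P_{\mathcal A}$ the orthogonal projection onto $\mathcal A$. A *space extension* is a family $E=\{E^t\}_{t\ge 0}$ of maps $E^t:\mathrm{Lat}\,\mathcal H\to\mathrm{Lat}\,\mathcal H$ with $E^0=\mathrm{id}$, $E^t\{0\}=\{0\}$, and $E^t\mathcal A\subseteq E^{t'}\mathcal A'$ whenever $t\le t'$, $\mathcal A\subseteq\mathcal A'$. One writes $E^tP_{\mathcal A}=P^t_{\mathcal A}:=P_{E^t\mathcal A}$. For $a\subset\mathrm{Lat}\,\mathcal H$, $\mathfrak N[E,a]$ is the minimal (unital) von Neumann algebra in $\mathfrak B(\mathcal H)$ that contains all $P_{\mathcal A}$, $\mathcal A\in a$, and such that $E^tP\in\mathfrak N[E,a]$ for every projection $P\in\mathfrak N[E,a]$ and $t>0$. *Eikonals* are the operators $\tau_P=\int_0^\infty t\,dP^t$, $P^t=E^tP$, with $P$ a projection in $\mathfrak N[E,a]$.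 The *bounded case* means that all eikonals are bounded operators and their norms are uniformly bounded. Then $\mathrm{Eik}\,\mathfrak N[E,a]$ denotes the strong operator closure of the set $\{\tau_P\}$, and its elements are also called eikonals. With the usual order of self-adjoint operators, an eikonal $\tau$ is *maximal* if $\tau\ge\tau'$ for every eikonal $\tau'$ comparable with $\tau$. The set $\Omega_{\mathfrak N[E,a]}$ of maximal eikonals is a metric space with the distance $\|\tau-\tau'\|$ (operator norm). **Wave spectrum of $L_0$.** Let $L$ be the Friedrichs extension of $L_0$, $\mathcal D=\mathrm{Ker}\,L_0^*$. For $h\in L_2^{\rm loc}((0,\infty);\mathcal H)$ (square integrable on bounded intervals $(0,T)$) put $$v^h(t)=\int_0^tL^{-1/2}\sin[(t-s)L^{1/2}]\,h(s)\,ds .$$ For $\mathcal A\in\mathrm{Lat}\,\mathcal H$, $t>0$, put $\mathcal V^t_{\mathcal A}=\{v^h(t): h\in L_2^{\rm loc}((0,\infty);\mathcal A)\}$. The space extension $E_L=\{E^t\}$ is $E^0\mathcal A=\mathcal A$, $E^t\mathcal A=\mathrm{clos}\,\mathcal V^t_{\mathcal A}$ for $t>0$. Let $\mathcal M_{\mathcal D}=\{h\in C^\infty([0,\infty);\mathcal D) : \mathrm{supp}\,h\subset(0,\infty)\}$, $\mathcal U^t=\{h(t)-v^{h''}(t) : h\in\mathcal M_{\mathcal D}\}$, $t\ge 0$, and $\mathfrak N_{L_0}=\mathfrak N[E_L,\{\mathrm{clos}\,\mathcal U^t\}_{t\ge0}]$. The *wave spectrum* is $\Omega_{L_0}=\Omega_{\mathfrak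 N_{L_0}}$. *)

theory Defs
  imports "HOL-Analysis.Analysis"
begin

section \<open>Complex Hilbert spaces\<close>

text \<open>A complex Hilbert space is a Banach space whose real structure comes from a complex one and
  whose norm comes from a sesquilinear form, linear in the first argument. Definiteness of the form
  follows from \<open>cinner_self\<close>. For a metric space, separability is the class
  \<^class>\<open>second_countable_topology\<close>.\<close>

class chilbert_space = banach +
  fixes scaleC :: "complex \<Rightarrow> 'a \<Rightarrow> 'a" (infixr "*\<^sub>C" 75)
    and cinner :: "'a \<Rightarrow> 'a \<Rightarrow> complex"
  assumes scaleC_add_right: "c *\<^sub>C (x + y) = c *\<^sub>C x + c *\<^sub>C y"
    and scaleC_add_left: "(c + d) *\<^sub>C x = c *\<^sub>C x + d *\<^sub>C x"
    and scaleC_scaleC: "c *\<^sub>C d *\<^sub>C x = (c * d) *\<^sub>C x"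
    and scaleR_scaleC: "r *\<^sub>R x = complex_of_real r *\<^sub>C x"
    and cinner_commute: "cinner x y = cnj (cinner y x)"
    and cinner_add_left: "cinner (x + y) z = cinner x z + cinner y z"
    and cinner_scaleC_left: "cinner (c *\<^sub>C x) y = c * cinner x y"
    and cinner_self: "cinner x x = complex_of_real ((norm x)\<^sup>2)"

definition unitary :: "('a::chilbert_space \<Rightarrow> 'b::chilbert_space) \<Rightarrow> bool" where
  "unitary U \<longleftrightarrow> (\<forall>x y. U (x + y) = U x + U y) \<and> (\<forall>c x. U (c *\<^sub>C x) = c *\<^sub>C U x) \<and>
     (\<forall>x y. cinner (U x) (U y) = cinner x y) \<and> surj U"

text \<open>The object determined by \<open>P\<close>. The value \<open>0\<close> in the absence of a unique one is a convention
  that makes the function total; it is not met where the function is used below.\<close>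

definition the_or_zero :: "('a::zero \<Rightarrow> bool) \<Rightarrow> 'a" where
  "the_or_zero P = (if \<exists>!x. P x then THE x. P x else 0)"


section \<open>Bounded operators\<close>

text \<open>The type of \<open>bounded_linear_function\<close>s consists of the real-linear bounded maps; \<open>\<BB>(\<H>)\<close> is
  the set of complex-linear ones among them, with the same operator norm.\<close>

definition bounded_ops :: "('a::chilbert_space \<Rightarrow>\<^sub>L 'a) set" where
  "bounded_ops = {T. \<forall>c x. blinfun_apply T (c *\<^sub>C x) = c *\<^sub>C blinfun_apply T x}"

definition is_adjoint :: "('a::chilbert_space \<Rightarrow>\<^sub>L 'a) \<Rightarrow> ('a \<Rightarrow>\<^sub>L 'a) \<Rightarrow> bool" where
  "is_adjoint T S \<longleftrightarrow> (\<forall>x y. cinner (blinfun_apply T x) y = cinner x (blinfun_apply S y))"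

definition projections :: "('a::chilbert_space \<Rightarrow>\<^sub>L 'a) set" where
  "projections = {P \<in> bounded_ops. P o\<^sub>L P = P \<and> is_adjoint P P}"

definition proj_onto :: "'a::chilbert_space set \<Rightarrow> ('a \<Rightarrow>\<^sub>L 'a)" where
  "proj_onto A = the_or_zero (\<lambda>P. P \<in> projections \<and> range (blinfun_apply P) = A)"

definition op_le :: "('a::chilbert_space \<Rightarrow>\<^sub>L 'a) \<Rightarrow> ('a \<Rightarrow>\<^sub>L 'a) \<Rightarrow> bool" where
  "op_le S T \<longleftrightarrow> (\<forall>x. Re (cinner (blinfun_apply S x) x) \<le> Re (cinner (blinfun_apply T x) x))"

definition von_neumann_algebra :: "('a::chilbert_space \<Rightarrow>\<^sub>L 'a) set \<Rightarrow> bool" where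
  "von_neumann_algebra M \<longleftrightarrow> M \<subseteq> bounded_ops \<and> id_blinfun \<in> M \<and>
     (\<forall>S\<in>M. \<forall>T\<in>M. S + T \<in> M) \<and> (\<forall>S\<in>M. \<forall>T\<in>M. S o\<^sub>L T \<in> M) \<and>
     (\<forall>c. \<forall>T\<in>M. Blinfun (\<lambda>x. c *\<^sub>C blinfun_apply T x) \<in> M) \<and>
     (\<forall>T\<in>M. \<exists>S\<in>M. is_adjoint T S) \<and>
     closedin strong_operator_topology M"


section \<open>Unbounded operators\<close>

text \<open>A not necessarily bounded operator is represented by its graph.\<close>

definition linear_operator :: "('a::chilbert_space \<times> 'a) set \<Rightarrow> bool" where
  "linear_operator L \<longleftrightarrow> (0, 0) \<in> L \<and>
     (\<forall>x y u v. (x, y) \<in> L \<longrightarrow> (u, v) \<in> L \<longrightarrow> (x + u, y + v) \<in> L) \<and>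
     (\<forall>c x y. (x, y) \<in> L \<longrightarrow> (c *\<^sub>C x, c *\<^sub>C y) \<in> L) \<and>
     single_valued L"

definition op_apply :: "('a \<times> 'a) set \<Rightarrow> 'a \<Rightarrow> 'a::chilbert_space" where
  "op_apply L x = the_or_zero (\<lambda>y. (x, y) \<in> L)"

definition op_graph :: "('a::chilbert_space \<Rightarrow>\<^sub>L 'a) \<Rightarrow> ('a \<times> 'a) set" where
  "op_graph T = {(x, blinfun_apply T x) | x. True}"

text \<open>The operator \<open>U L U\<^sup>*\<close> for a unitary \<open>U\<close>; its domain is the image of the domain of \<open>L\<close>.\<close>

definition unitary_conj :: "('a \<Rightarrow> 'b) \<Rightarrow> ('a::chilbert_space \<times> 'a) set \<Rightarrow> ('b::chilbert_space \<times> 'b) set" where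
  "unitary_conj U L = {(U x, U y) | x y. (x, y) \<in> L}"

definition densely_defined :: "('a::chilbert_space \<times> 'a) set \<Rightarrow> bool" where
  "densely_defined L \<longleftrightarrow> closure (Domain L) = UNIV"

definition symmetric_op :: "('a::chilbert_space \<times> 'a) set \<Rightarrow> bool" where
  "symmetric_op L \<longleftrightarrow> (\<forall>x y u v. (x, y) \<in> L \<longrightarrow> (u, v) \<in> L \<longrightarrow> cinner y u = cinner x v)"

definition positive_definite :: "('a::chilbert_space \<times> 'a) set \<Rightarrow> bool" where
  "positive_definite L \<longleftrightarrow> (\<exists>\<kappa>>0. \<forall>x y. (x, y) \<in> L \<longrightarrow> Re (cinner y x) \<ge> \<kappa> * (norm x)\<^sup>2)"

definition adjoint_op :: "('a::chilbert_space \<times> 'a) set \<Rightarrow> ('a \<times> 'a) set" where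
  "adjoint_op L = {(u, v). \<forall>x y. (x, y) \<in> L \<longrightarrow> cinner y u = cinner x v}"

definition op_kernel :: "('a::chilbert_space \<times> 'a) set \<Rightarrow> 'a set" where
  "op_kernel L = {x. (x, 0) \<in> L}"

definition defect_subspace :: "('a::chilbert_space \<times> 'a) set \<Rightarrow> complex \<Rightarrow> 'a set" where
  "defect_subspace L z = {x. (x, z *\<^sub>C x) \<in> adjoint_op L}"

text \<open>The defect indexes are the dimensions of the two defect subspaces.\<close>

definition nonzero_defect_indexes :: "('a::chilbert_space \<times> 'a) set \<Rightarrow> bool" where
  "nonzero_defect_indexes L \<longleftrightarrow> defect_subspace L \<i> \<noteq> {0} \<and> defect_subspace L (- \<i>) \<noteq> {0}"

text \<open>The form domain is the completion of the domain of \<open>L\<close> in the norm given by the quadratic form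
  of \<open>L\<close>, realised inside the Hilbert space; the Friedrichs extension is the restriction of the
  adjoint of \<open>L\<close> to it.\<close>

definition form_domain :: "('a::chilbert_space \<times> 'a) set \<Rightarrow> 'a set" where
  "form_domain L = {x. \<exists>u v. (\<forall>n::nat. (u n, v n) \<in> L) \<and> u \<longlonglongrightarrow> x \<and>
     (\<forall>e>0. \<exists>N. \<forall>m\<ge>N. \<forall>n\<ge>N. Re (cinner (v m - v n) (u m - u n)) < e)}"

definition friedrichs_extension :: "('a::chilbert_space \<times> 'a) set \<Rightarrow> ('a \<times> 'a) set" where
  "friedrichs_extension L = {(x, y) \<in> adjoint_op L. x \<in> form_domain L}"


section \<open>Operator-valued Stieltjes integrals and functional calculus\<close>

text \<open>\<open>y = \<integral>\<^bsub>[0,T]\<^esub> f(t) dF(t) x\<close> as a limit of Riemann--Stieltjes sums when the mesh tends to \<open>0\<close>.\<close>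

definition has_rs_integral ::
  "(real \<Rightarrow> real) \<Rightarrow> (real \<Rightarrow> 'a::chilbert_space \<Rightarrow>\<^sub>L 'a) \<Rightarrow> real \<Rightarrow> 'a \<Rightarrow> 'a \<Rightarrow> bool" where
  "has_rs_integral f F T x y \<longleftrightarrow> (\<forall>e>0. \<exists>d>0. \<forall>p. p tagged_division_of {0..T} \<and> (\<lambda>\<xi>. ball \<xi> d) fine p \<longrightarrow>
     norm ((\<Sum>(\<xi>, K)\<in>p. f \<xi> *\<^sub>R (blinfun_apply (F (Sup K)) x - blinfun_apply (F (Inf K)) x)) - y) < e)"

text \<open>The operator \<open>\<integral>\<^sub>0\<^sup>\<infinity> f(t) dF(t)\<close> on the domain where the integral converges strongly.\<close>

definition stieltjes_op ::
  "(real \<Rightarrow> real) \<Rightarrow> (real \<Rightarrow> 'a::chilbert_space \<Rightarrow>\<^sub>L 'a) \<Rightarrow> ('a \<times> 'a) set" where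
  "stieltjes_op f F = {(x, y). \<exists>I. (\<forall>T>0. has_rs_integral f F T x (I T)) \<and> (I \<longlongrightarrow> y) at_top}"

text \<open>\<open>E\<close> is the spectral family of the positive definite self-adjoint operator \<open>L\<close>, normalised to be
  continuous from the right. Since \<open>L \<ge> \<kappa>\<close> with \<open>\<kappa> > 0\<close>, the family vanishes on \<open>(-\<infinity>, \<kappa>)\<close> and all
  integrals can be taken over \<open>(0, \<infinity>)\<close>; the values of the integrands near \<open>0\<close> do not matter.\<close>

definition spectral_family_of ::
  "('a::chilbert_space \<times> 'a) set \<Rightarrow> (real \<Rightarrow> 'a \<Rightarrow>\<^sub>L 'a) \<Rightarrow> bool" where
  "spectral_family_of L E \<longleftrightarrow> (\<forall>s. E s \<in> projections) \<and> (\<forall>s\<le>0. E s = 0) \<and>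
     (\<forall>s t. s \<le> t \<longrightarrow> E s o\<^sub>L E t = E s) \<and>
     (\<forall>s x. ((\<lambda>t. blinfun_apply (E t) x) \<longlongrightarrow> blinfun_apply (E s) x) (at_right s)) \<and>
     (\<forall>x. ((\<lambda>t. blinfun_apply (E t) x) \<longlongrightarrow> x) at_top) \<and>
     L = stieltjes_op (\<lambda>s. s) E"

definition op_function :: "(real \<Rightarrow> real) \<Rightarrow> ('a::chilbert_space \<times> 'a) set \<Rightarrow> ('a \<times> 'a) set" where
  "op_function f L = {(x, y). \<exists>E. spectral_family_of L E \<and> (x, y) \<in> stieltjes_op f E}"


section \<open>Algebras with space extension and their eikonals\<close>

text \<open>A family of maps on closed subspaces is a function \<open>real \<Rightarrow> 'a set \<Rightarrow> 'a set\<close>, of which only the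
  values at closed subspaces and nonnegative reals are used.\<close>

definition extend_proj ::
  "(real \<Rightarrow> 'a set \<Rightarrow> 'a set) \<Rightarrow> real \<Rightarrow> ('a::chilbert_space \<Rightarrow>\<^sub>L 'a) \<Rightarrow> ('a \<Rightarrow>\<^sub>L 'a)" where
  "extend_proj E t P = proj_onto (E t (range (blinfun_apply P)))"

definition ext_algebra ::
  "(real \<Rightarrow> 'a set \<Rightarrow> 'a set) \<Rightarrow> 'a set set \<Rightarrow> ('a::chilbert_space \<Rightarrow>\<^sub>L 'a) set" where
  "ext_algebra E a = \<Inter>{M. von_neumann_algebra M \<and> (\<forall>A\<in>a. proj_onto A \<in> M) \<and>
     (\<forall>P \<in> M \<inter> projections. \<forall>t>0. extend_proj E t P \<in> M)}"

definition eikonal_op ::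
  "(real \<Rightarrow> 'a set \<Rightarrow> 'a set) \<Rightarrow> ('a::chilbert_space \<Rightarrow>\<^sub>L 'a) \<Rightarrow> ('a \<times> 'a) set" where
  "eikonal_op E P = stieltjes_op (\<lambda>t. t) (\<lambda>t. extend_proj E t P)"

definition bounded_case ::
  "(real \<Rightarrow> 'a set \<Rightarrow> 'a set) \<Rightarrow> 'a::chilbert_space set set \<Rightarrow> bool" where
  "bounded_case E a \<longleftrightarrow> (\<exists>C. \<forall>P \<in> ext_algebra E a \<inter> projections.
     \<exists>T\<in>bounded_ops. eikonal_op E P = op_graph T \<and> norm T \<le> C)"

definition eikonals ::
  "(real \<Rightarrow> 'a set \<Rightarrow> 'a set) \<Rightarrow> 'a set set \<Rightarrow> ('a::chilbert_space \<Rightarrow>\<^sub>L 'a) set" where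
  "eikonals E a = strong_operator_topology closure_of
     {T \<in> bounded_ops. \<exists>P \<in> ext_algebra E a \<inter> projections. eikonal_op E P = op_graph T}"

definition maximal_eikonals ::
  "(real \<Rightarrow> 'a set \<Rightarrow> 'a set) \<Rightarrow> 'a set set \<Rightarrow> ('a::chilbert_space \<Rightarrow>\<^sub>L 'a) set" where
  "maximal_eikonals E a = {\<tau> \<in> eikonals E a.
     \<forall>\<tau>' \<in> eikonals E a. op_le \<tau> \<tau>' \<or> op_le \<tau>' \<tau> \<longrightarrow> op_le \<tau>' \<tau>}"


section \<open>The wave spectrum\<close>

definition L2_loc :: "'a::{chilbert_space, second_countable_topology} set \<Rightarrow> (real \<Rightarrow> 'a) set" where
  "L2_loc A = {h. set_borel_measurable lborel {0<..} h \<and> (\<forall>t>0. h t \<in> A) \<and>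
     (\<forall>T>0. set_integrable lborel {0<..<T} (\<lambda>t. (norm (h t))\<^sup>2))}"

definition wave :: "('a \<times> 'a) set \<Rightarrow> (real \<Rightarrow> 'a) \<Rightarrow> real \<Rightarrow> 'a::{chilbert_space, second_countable_topology}" where
  "wave L h t = (LINT s:{0..t}|lborel.
     op_apply (op_function (\<lambda>r. 1 / sqrt r) L)
       (op_apply (op_function (\<lambda>r. sin ((t - s) * sqrt r)) L) (h s)))"

definition wave_extension ::
  "('a \<times> 'a) set \<Rightarrow> real \<Rightarrow> 'a set \<Rightarrow> 'a::{chilbert_space, second_countable_topology} set" where
  "wave_extension L t A = (if t = 0 then A else closure {wave L h t | h. h \<in> L2_loc A})"

definition time_deriv :: "(real \<Rightarrow> 'a::real_normed_vector) \<Rightarrow> real \<Rightarrow> 'a" where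
  "time_deriv h t = vector_derivative h (at t within {0..})"

text \<open>\<open>C\<^sup>\<infinity>([0,\<infinity>);D)\<close> with the support, a closed subset of \<open>[0,\<infinity>)\<close>, contained in \<open>(0,\<infinity>)\<close>: the
  function vanishes near \<open>0\<close>.\<close>

definition smooth_controls :: "'a::chilbert_space set \<Rightarrow> (real \<Rightarrow> 'a) set" where
  "smooth_controls D = {h. (\<forall>t\<ge>0. h t \<in> D) \<and>
     (\<forall>n. \<forall>t\<ge>0. (time_deriv ^^ n) h differentiable (at t within {0..})) \<and>
     (\<exists>e>0. \<forall>t. 0 \<le> t \<and> t < e \<longrightarrow> h t = 0)}"

definition reachable_set ::
  "('a \<times> 'a) set \<Rightarrow> real \<Rightarrow> 'a::{chilbert_space, second_countable_topology} set" where
  "reachable_set L0 t = {h t - wave (friedrichs_extension L0) (time_deriv (time_deriv h)) t | h.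
     h \<in> smooth_controls (op_kernel (adjoint_op L0))}"

definition reachable_family ::
  "('a \<times> 'a) set \<Rightarrow> 'a::{chilbert_space, second_countable_topology} set set" where
  "reachable_family L0 = {closure (reachable_set L0 t) | t. t \<ge> 0}"

definition wave_spectrum_defined ::
  "('a::{chilbert_space, second_countable_topology} \<times> 'a) set \<Rightarrow> bool" where
  "wave_spectrum_defined L0 \<longleftrightarrow>
     bounded_case (wave_extension (friedrichs_extension L0)) (reachable_family L0)"

definition wave_spectrum ::
  "('a \<times> 'a) set \<Rightarrow> ('a::{chilbert_space, second_countable_topology} \<Rightarrow>\<^sub>L 'a) set" where
  "wave_spectrum L0 =
     maximal_eikonals (wave_extension (friedrichs_extension L0)) (reachable_family L0)"

text \<open>For sets of bounded operators, \<^const>\<open>dist\<close> is the distance in the operator norm.\<close>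

definition isometric :: "'a::metric_space set \<Rightarrow> 'b::metric_space set \<Rightarrow> bool" where
  "isometric X Y \<longleftrightarrow> (\<exists>\<phi>. bij_betw \<phi> X Y \<and> (\<forall>x\<in>X. \<forall>y\<in>X. dist (\<phi> x) (\<phi> y) = dist x y))"

end

theory Submission
  imports Defs
begin

text \<open>Every construction leading from \<open>L\<^sub>0\<close> to its wave spectrum commutes with unitary
  equivalence, so \<open>T \<mapsto> U T U\<^sup>*\<close> carries the maximal eikonals of \<open>L\<^sub>0\<close> onto those of \<open>U L\<^sub>0 U\<^sup>*\<close>,
  and it preserves the operator norm.\<close>

section \<open>Conjugation by a unitary operator\<close>

text \<open>A bijection carries unique witnesses to unique witnesses, and \<open>f 0 = 0\<close>
  makes the default values correspond. Objects described by \<open>the_or_zero\<close> can thus be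
  transported without a proof that they exist.\<close>

lemma the_or_zero_transfer:
  assumes "\<And>x. g (f x) = x" and "\<And>y. f (g y) = y" and "f 0 = 0"
    and "\<And>x. Q (f x) \<longleftrightarrow> P x"
  shows "the_or_zero Q = f (the_or_zero P)"
proof (cases "\<exists>!x. P x")
  case True
  then obtain x where x: "P x" "\<And>x'. P x' \<Longrightarrow> x' = x"
    by blast
  have "y = f x" if "Q y" for y
    using that x(2) [of "g y"] assms(2) [of y] assms(4) [of "g y"] by simp
  moreover have "Q (f x)"
    using x(1) assms(4) by simp
  ultimately have "\<exists>!y. Q y" "(THE y. Q y) = f x"
    by blast+
  moreover have "(THE x. P x) = x"
    using x by blast
  ultimately show ?thesis
    using True by (simp add: the_or_zero_def)
next
  case False
  have "\<not> (\<exists>!y. Q y)"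
  proof
    assume "\<exists>!y. Q y"
    then obtain y where y: "Q y" "\<And>y'. Q y' \<Longrightarrow> y' = y"
      by blast
    have "x = g y" if "P x" for x
      using that y(2) [of "f x"] assms(1) [of x] assms(4) [of x] by simp
    moreover have "P (g y)"
      using y(1) assms(2) [of y] assms(4) [of "g y"] by simp
    ultimately show False
      using False by blast
  qed
  with False assms(3) show ?thesis
    by (simp add: the_or_zero_def)
qed

lemma norm_scaleC: "norm (c *\<^sub>C x) = cmod c * norm x"
  for x :: "'a::chilbert_space"
proof -
  have "cinner (c *\<^sub>C x) (c *\<^sub>C x) = c * cnj c * cinner x x"
    by (metis cinner_commute cinner_scaleC_left complex_cnj_mult mult.assoc)
  also have "\<dots> = complex_of_real ((cmod c * norm x)\<^sup>2)"
    by (simp add: cinner_self power_mult_distrib flip: complex_norm_square)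
  finally have "(norm (c *\<^sub>C x))\<^sup>2 = (cmod c * norm x)\<^sup>2"
    by (simp only: cinner_self of_real_eq_iff)
  then show ?thesis
    by (simp add: power2_eq_iff_nonneg)
qed

text \<open>\<open>von_neumann_algebra\<close> expresses complex multiples through
  \<open>Blinfun\<close>, which represents the given map only if that map is bounded and
  linear.\<close>

lemma bounded_linear_scaleC: "bounded_linear (\<lambda>x. c *\<^sub>C x :: 'a::chilbert_space)"
  by (rule bounded_linear_intro [where K = "cmod c"])
    (simp_all add: scaleC_add_right scaleR_scaleC scaleC_scaleC norm_scaleC mult.commute)

text \<open>The inverse is a parameter, so that by \<open>inverse_pair\<close> every result also
  holds with \<open>U\<close> and \<open>V\<close> exchanged. Several equalities below are one
  inclusion used twice: for \<open>U\<close>, and for \<open>V\<close> on the transported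
  object.\<close>

locale unitary_pair =
  fixes U :: "'a::chilbert_space \<Rightarrow> 'b::chilbert_space" and V :: "'b \<Rightarrow> 'a"
  assumes unitary_U: "unitary U"
    and V_U [simp]: "V (U x) = x"
    and U_V [simp]: "U (V y) = y"
begin

lemma U_add: "U (x + y) = U x + U y"
  and U_scaleC: "U (c *\<^sub>C x) = c *\<^sub>C U x"
  and cinner_U [simp]: "cinner (U x) (U y) = cinner x y"
  using unitary_U by (auto simp: unitary_def)

lemma norm_U [simp]: "norm (U x) = norm x"
proof -
  have "complex_of_real ((norm (U x))\<^sup>2) = complex_of_real ((norm x)\<^sup>2)"
    by (simp only: cinner_self [symmetric] cinner_U)
  then have "(norm (U x))\<^sup>2 = (norm x)\<^sup>2"
    by (simp only: of_real_eq_iff)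
  then show ?thesis
    by simp
qed

lemma U_eq_iff [simp]: "U x = U y \<longleftrightarrow> x = y"
  by (metis V_U)

lemma inj_U: "inj U"
  by (rule injI) simp

lemma V_eq_iff_eq_U: "V y = x \<longleftrightarrow> y = U x"
  by auto

lemma inverse_pair: "unitary_pair V U"
proof
  have "V (x + y) = V x + V y" for x y
    by (metis U_add U_V V_U)
  moreover have "V (c *\<^sub>C x) = c *\<^sub>C V x" for c x
    by (metis U_scaleC U_V V_U)
  moreover have "cinner (V x) (V y) = cinner x y" for x y
    by (metis cinner_U U_V)
  moreover have "surj V"
    by (rule surjI) (rule V_U)
  ultimately show "unitary V"
    by (simp add: unitary_def)
qed simp_all

lemma bounded_linear_U: "bounded_linear U"
  by (rule bounded_linear_intro [where K = 1]) (simp_all add: U_add scaleR_scaleC U_scaleC)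

lemmas bounded_linear_V = unitary_pair.bounded_linear_U [OF inverse_pair]

lemmas cinner_V [simp] = unitary_pair.cinner_U [OF inverse_pair]
lemmas norm_V [simp] = unitary_pair.norm_U [OF inverse_pair]
lemmas V_eq_iff [simp] = unitary_pair.U_eq_iff [OF inverse_pair]
lemmas V_scaleC = unitary_pair.U_scaleC [OF inverse_pair]

lemmas U_zero [simp] = linear_0 [OF bounded_linear.linear [OF bounded_linear_U]]
lemmas V_zero [simp] = linear_0 [OF bounded_linear.linear [OF bounded_linear_V]]
lemmas U_diff = linear_diff [OF bounded_linear.linear [OF bounded_linear_U]]
lemmas V_diff = linear_diff [OF bounded_linear.linear [OF bounded_linear_V]]
lemmas U_scaleR = linear_scale [OF bounded_linear.linear [OF bounded_linear_U]]
lemmas U_sum = linear_sum [OF bounded_linear.linear [OF bounded_linear_U]]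

lemma mem_image_U [simp]: "y \<in> U ` A \<longleftrightarrow> V y \<in> A"
  by (metis image_iff V_U U_V)

lemma tendsto_U_iff: "((\<lambda>n. U (f n)) \<longlongrightarrow> U x) F \<longleftrightarrow> (f \<longlongrightarrow> x) F"
proof
  assume "((\<lambda>n. U (f n)) \<longlongrightarrow> U x) F"
  from bounded_linear.tendsto [OF bounded_linear_V this] show "(f \<longlongrightarrow> x) F"
    by simp
qed (rule bounded_linear.tendsto [OF bounded_linear_U])

lemma tendsto_V_iff: "((\<lambda>n. V (f n)) \<longlongrightarrow> V x) F \<longleftrightarrow> (f \<longlongrightarrow> x) F"
  by (rule unitary_pair.tendsto_U_iff [OF inverse_pair])

text \<open>Continuity of \<open>U\<close> gives one inclusion, continuity of \<open>V\<close> the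
  other.\<close>

lemma closure_image_U: "closure (U ` A) = U ` closure A"
proof
  have "U ` closure B \<subseteq> closure (U ` B)" for B
    by (rule image_closure_subset)
      (auto intro: linear_continuous_on bounded_linear_U closure_subset [THEN subsetD])
  then show "U ` closure A \<subseteq> closure (U ` A)" .
  have "V ` closure (U ` A) \<subseteq> closure (V ` U ` A)"
    by (rule image_closure_subset)
      (auto intro: linear_continuous_on bounded_linear_V closure_subset [THEN subsetD] simp del: mem_image_U)
  then show "closure (U ` A) \<subseteq> U ` closure A"
    by (auto simp: image_image)
qed


subsection \<open>Unbounded operators\<close>

lemma mem_unitary_conj [simp]: "(x, y) \<in> unitary_conj U L \<longleftrightarrow> (V x, V y) \<in> L"
  unfolding unitary_conj_def by (auto) (metis U_V)

lemma unitary_conj_inverse [simp]: "unitary_conj V (unitary_conj U L) = L"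
  by (auto simp: unitary_pair.mem_unitary_conj [OF inverse_pair])

lemma unitary_conj_eq_iff: "unitary_conj U L = unitary_conj U L' \<longleftrightarrow> L = L'"
  by (metis unitary_conj_inverse)

lemma op_apply_unitary_conj: "op_apply (unitary_conj U L) (U x) = U (op_apply L x)"
  unfolding op_apply_def by (rule the_or_zero_transfer [where g = V]) simp_all

lemma adjoint_op_unitary_conj: "adjoint_op (unitary_conj U L) = unitary_conj U (adjoint_op L)"
proof -
  \<comment> \<open>Both inner products are moved back by \<open>V\<close>; since \<open>V\<close>
    is onto, the pairs \<open>(V x, V y)\<close> run through the whole graph of
    \<open>L\<close>.\<close>
  have "(\<forall>x y. (V x, V y) \<in> L \<longrightarrow> cinner y u = cinner x v) \<longleftrightarrow>
      (\<forall>x y. (x, y) \<in> L \<longrightarrow> cinner y (V u) = cinner x (V v))" for u v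
    by (metis U_V V_U cinner_V)
  then show ?thesis
    by (auto simp: adjoint_op_def)
qed

lemma op_kernel_unitary_conj: "op_kernel (unitary_conj U L) = U ` op_kernel L"
  by (auto simp: op_kernel_def simp del: mem_image_U) (simp add: image_iff, metis U_V)

text \<open>\<open>V\<close> maps an approximating sequence to one for \<open>L\<close>: it is
  continuous, and it leaves the quadratic form of the differences unchanged.\<close>

lemma form_domain_unitary_conj_subset: "form_domain (unitary_conj U L) \<subseteq> U ` form_domain L"
proof
  fix x assume "x \<in> form_domain (unitary_conj U L)"
  then obtain u v where uv: "\<forall>n::nat. (V (u n), V (v n)) \<in> L" "u \<longlonglongrightarrow> x"
    "\<forall>e>0. \<exists>N. \<forall>m\<ge>N. \<forall>n\<ge>N. Re (cinner (v m - v n) (u m - u n)) < e"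
    unfolding form_domain_def by auto
  have "Re (cinner (V (v m) - V (v n)) (V (u m) - V (u n))) = Re (cinner (v m - v n) (u m - u n))" for m n
    by (simp flip: V_diff)
  with uv have "V x \<in> form_domain L"
    unfolding form_domain_def
    by (intro CollectI exI [of _ "\<lambda>n. V (u n)"] exI [of _ "\<lambda>n. V (v n)"]) (simp add: tendsto_V_iff)
  then show "x \<in> U ` form_domain L"
    by simp
qed

lemma form_domain_unitary_conj: "form_domain (unitary_conj U L) = U ` form_domain L"
proof
  have "form_domain L \<subseteq> V ` form_domain (unitary_conj U L)"
    using unitary_pair.form_domain_unitary_conj_subset [OF inverse_pair, of "unitary_conj U L"] by simp
  then show "U ` form_domain L \<subseteq> form_domain (unitary_conj U L)"
    by auto
qed (rule form_domain_unitary_conj_subset)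

lemma friedrichs_extension_unitary_conj:
  "friedrichs_extension (unitary_conj U L) = unitary_conj U (friedrichs_extension L)"
  by (auto simp: friedrichs_extension_def adjoint_op_unitary_conj form_domain_unitary_conj)


subsection \<open>Bounded operators\<close>

text \<open>This is \<open>U\<close> composed with \<open>T\<close> and the adjoint of
  \<open>U\<close>; by unitarity, \<open>V\<close> is that adjoint.\<close>

definition conj_op :: "('a \<Rightarrow>\<^sub>L 'a) \<Rightarrow> ('b \<Rightarrow>\<^sub>L 'b)" where
  "conj_op T = Blinfun U o\<^sub>L T o\<^sub>L Blinfun V"

lemma conj_op_apply [simp]: "blinfun_apply (conj_op T) y = U (blinfun_apply T (V y))"
  by (simp add: conj_op_def bounded_linear_Blinfun_apply bounded_linear_U bounded_linear_V)

lemma conj_op_inverse [simp]: "unitary_pair.conj_op V U (conj_op T) = T"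
  by (rule blinfun_eqI) (simp add: unitary_pair.conj_op_apply [OF inverse_pair])

lemma conj_op_inverse' [simp]: "conj_op (unitary_pair.conj_op V U S) = S"
  by (rule blinfun_eqI) (simp add: unitary_pair.conj_op_apply [OF inverse_pair])

lemma conj_op_eq_iff [simp]: "conj_op S = conj_op T \<longleftrightarrow> S = T"
  by (metis conj_op_inverse)

lemma conj_op_add: "conj_op (S + T) = conj_op S + conj_op T"
  by (rule blinfun_eqI) (simp add: U_add blinfun.add_left)

lemma conj_op_diff: "conj_op (S - T) = conj_op S - conj_op T"
  by (rule blinfun_eqI) (simp add: U_diff blinfun.diff_left)

lemma conj_op_compose: "conj_op (S o\<^sub>L T) = conj_op S o\<^sub>L conj_op T"
  by (rule blinfun_eqI) simp

lemma conj_op_zero [simp]: "conj_op 0 = 0"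
  by (rule blinfun_eqI) simp

lemma conj_op_id [simp]: "conj_op id_blinfun = id_blinfun"
  by (rule blinfun_eqI) simp

lemma norm_conj_op_le: "norm (conj_op T) \<le> norm T"
proof (rule norm_blinfun_bound)
  show "norm (blinfun_apply (conj_op T) y) \<le> norm T * norm y" for y
    using norm_blinfun [of T "V y"] by simp
qed simp

lemma norm_conj_op [simp]: "norm (conj_op T) = norm T"
  using norm_conj_op_le [of T] unitary_pair.norm_conj_op_le [OF inverse_pair, of "conj_op T"] by simp

lemma dist_conj_op: "dist (conj_op S) (conj_op T) = dist S T"
  by (simp add: dist_norm flip: conj_op_diff)

lemma op_le_conj_op [simp]: "op_le (conj_op S) (conj_op T) \<longleftrightarrow> op_le S T"
proof -
  \<comment> \<open>Writing \<open>y\<close> as \<open>U (V y)\<close> moves the quadratic form to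
    the first space; as \<open>V\<close> is onto, \<open>V y\<close> is an arbitrary vector
    there.\<close>
  have "cinner (U (blinfun_apply R (V y))) y = cinner (blinfun_apply R (V y)) (V y)" for R y
    by (metis U_V cinner_U)
  then show ?thesis
    unfolding op_le_def conj_op_apply by (metis V_U)
qed

lemma is_adjoint_conj_op [simp]: "is_adjoint (conj_op S) (conj_op T) \<longleftrightarrow> is_adjoint S T"
proof -
  have "cinner (U x) y = cinner x (V y)" "cinner y (U x) = cinner (V y) x" for x y
    by (metis U_V cinner_U)+
  then show ?thesis
    unfolding is_adjoint_def conj_op_apply by (metis V_U)
qed

lemma bounded_ops_conj_op [simp]: "conj_op T \<in> bounded_ops \<longleftrightarrow> T \<in> bounded_ops"
  unfolding bounded_ops_def
  by (simp add: V_scaleC flip: U_scaleC) (metis V_U)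

lemma projections_conj_op [simp]: "conj_op P \<in> projections \<longleftrightarrow> P \<in> projections"
  by (simp add: projections_def flip: conj_op_compose)

lemma range_conj_op: "range (blinfun_apply (conj_op T)) = U ` range (blinfun_apply T)"
proof -
  have "range V = UNIV"
    by (rule surjI) (rule V_U)
  then have "U ` range (blinfun_apply T) = U ` blinfun_apply T ` range V"
    by simp
  then show ?thesis
    by (simp add: image_image)
qed

lemma op_graph_conj_op: "op_graph (conj_op T) = unitary_conj U (op_graph T)"
proof -
  have mem: "(x, y) \<in> op_graph S \<longleftrightarrow> y = blinfun_apply S x"
    for x y and S :: "'c::chilbert_space \<Rightarrow>\<^sub>L 'c"
    by (auto simp: op_graph_def)
  show ?thesis
    by (auto simp: mem V_eq_iff_eq_U)
qed

text \<open>\<open>conj_op\<close> is a bijection that fixes zero, respects projections and maps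
  ranges by \<open>U\<close>. The default value in \<open>proj_onto\<close> is transported too, so
  \<open>A\<close> may be any set.\<close>

lemma proj_onto_image: "proj_onto (U ` A) = conj_op (proj_onto A)"
  unfolding proj_onto_def
  by (rule the_or_zero_transfer [where g = "unitary_pair.conj_op V U"])
    (simp_all add: range_conj_op inj_image_eq_iff [OF inj_U] del: conj_op_apply)

text \<open>Strong continuity is tested on single vectors, and at \<open>y\<close> the map is
  evaluation at \<open>V y\<close> followed by the continuous \<open>U\<close>.\<close>

lemma continuous_map_conj_op:
  "continuous_map strong_operator_topology strong_operator_topology conj_op"
proof -
  have "continuous_map strong_operator_topology euclidean (\<lambda>T. U (blinfun_apply T (V y)))" for y
    using continuous_map_compose [OF strong_operator_topology_continuous_evaluation,
        of euclidean U] linear_continuous_on [OF bounded_linear_U]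
    by (simp add: o_def)
  then show ?thesis
    by (simp add: continuous_on_strong_operator_topo_iff_coordinatewise)
qed

lemma homeomorphic_map_conj_op:
  "homeomorphic_map strong_operator_topology strong_operator_topology conj_op"
  unfolding homeomorphic_map_maps homeomorphic_maps_def
  using continuous_map_conj_op unitary_pair.continuous_map_conj_op [OF inverse_pair] by force

lemma von_neumann_algebra_image_conj_op:
  assumes "von_neumann_algebra M"
  shows "von_neumann_algebra (conj_op ` M)"
proof -
  \<comment> \<open>This is where complex linearity of \<open>U\<close> enters. The other algebraic
    closure properties follow from the rules for sums, products and adjoints, strong closedness from
    the homeomorphism.\<close>
  have scale: "Blinfun (\<lambda>x. c *\<^sub>C blinfun_apply (conj_op T) x)
      = conj_op (Blinfun (\<lambda>x. c *\<^sub>C blinfun_apply T x))" for c T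
  proof -
    have T: "bounded_linear (\<lambda>x. c *\<^sub>C blinfun_apply T x)"
      using bounded_linear_compose [OF bounded_linear_scaleC blinfun.bounded_linear_right] .
    have "(\<lambda>x. c *\<^sub>C blinfun_apply (conj_op T) x)
        = blinfun_apply (conj_op (Blinfun (\<lambda>x. c *\<^sub>C blinfun_apply T x)))"
      by (simp add: fun_eq_iff bounded_linear_Blinfun_apply [OF T] U_scaleC)
    then show ?thesis
      by (simp only: blinfun_apply_inverse)
  qed
  have "closedin strong_operator_topology (conj_op ` M)"
    using assms homeomorphic_map_closedness_eq [OF homeomorphic_map_conj_op, of M]
    by (simp add: von_neumann_algebra_def closedin_def)
  moreover have "id_blinfun \<in> conj_op ` M"
    using assms conj_op_id by (metis von_neumann_algebra_def image_eqI)
  ultimately show ?thesis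
    using assms
    by (auto simp: von_neumann_algebra_def scale simp del: conj_op_apply simp flip: conj_op_add conj_op_compose)
qed


subsection \<open>Stieltjes integrals and functional calculus\<close>

lemma has_rs_integral_conj_op:
  "has_rs_integral f (\<lambda>t. conj_op (F t)) T x y \<longleftrightarrow> has_rs_integral f F T (V x) (V y)"
proof -
  have "norm ((\<Sum>(\<xi>, K)\<in>p. f \<xi> *\<^sub>R (blinfun_apply (conj_op (F (Sup K))) x
        - blinfun_apply (conj_op (F (Inf K))) x)) - y)
      = norm ((\<Sum>(\<xi>, K)\<in>p. f \<xi> *\<^sub>R (blinfun_apply (F (Sup K)) (V x)
        - blinfun_apply (F (Inf K)) (V x))) - V y)" (is "?l = norm ?r") for p
  proof -
    \<comment> \<open>Every Riemann-Stieltjes sum, and so its deviation from the limit, is the image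
      under \<open>U\<close> of the one for \<open>F\<close>; the same mesh bound works on both
      sides.\<close>
    have "?l = norm (U ?r)"
      by (simp add: U_diff U_sum U_scaleR case_prod_unfold)
    then show ?thesis
      by simp
  qed
  then show ?thesis
    unfolding has_rs_integral_def by simp
qed

lemma stieltjes_op_conj_op: "stieltjes_op f (\<lambda>t. conj_op (F t)) = unitary_conj U (stieltjes_op f F)"
proof -
  \<comment> \<open>The left side is the condition for the conjugated family after
    \<open>has_rs_integral_conj_op\<close>. The integrals over bounded intervals are matched by
    \<open>V\<close> in one direction and by \<open>U\<close> in the other.\<close>
  have "(\<exists>I. (\<forall>T>0. has_rs_integral f F T (V x) (V (I T))) \<and> (I \<longlongrightarrow> y) at_top) \<longleftrightarrow>
      (\<exists>I. (\<forall>T>0. has_rs_integral f F T (V x) (I T)) \<and> (I \<longlongrightarrow> V y) at_top)" (is "?l \<longleftrightarrow> ?r") for x y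
  proof
    assume ?l
    then obtain I where "\<forall>T>0. has_rs_integral f F T (V x) (V (I T))" "(I \<longlongrightarrow> y) at_top"
      by blast
    then show ?r
      by (intro exI [of _ "\<lambda>T. V (I T)"]) (simp add: tendsto_V_iff)
  next
    assume ?r
    then obtain I where "\<forall>T>0. has_rs_integral f F T (V x) (I T)" "(I \<longlongrightarrow> V y) at_top"
      by blast
    then show ?l
      using tendsto_U_iff [of I "V y" at_top] by (intro exI [of _ "\<lambda>T. U (I T)"]) simp
  qed
  then show ?thesis
    unfolding set_eq_iff stieltjes_op_def split_paired_All mem_unitary_conj mem_Collect_eq prod.case
      has_rs_integral_conj_op by blast
qed

lemma spectral_family_of_conj_op:
  assumes "spectral_family_of L E"
  shows "spectral_family_of (unitary_conj U L) (\<lambda>t. conj_op (E t))"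
proof -
  \<comment> \<open>Here the limit is the bare \<open>x\<close>, which has to be read as
    \<open>U (V x)\<close> before \<open>tendsto_U_iff\<close> fits.\<close>
  have "((\<lambda>t. U (blinfun_apply (E t) (V x))) \<longlongrightarrow> x) at_top" for x
    using assms tendsto_U_iff [of "\<lambda>t. blinfun_apply (E t) (V x)" "V x" at_top]
    by (simp add: spectral_family_of_def)
  then show ?thesis
    using assms unfolding spectral_family_of_def
    by (simp add: stieltjes_op_conj_op tendsto_U_iff flip: conj_op_compose)
qed

lemma op_function_unitary_conj_subset:
  "unitary_conj U (op_function f L) \<subseteq> op_function f (unitary_conj U L)"
proof (rule subrelI)
  fix x y assume "(x, y) \<in> unitary_conj U (op_function f L)"
  then obtain E where "spectral_family_of L E" "(V x, V y) \<in> stieltjes_op f E"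
    by (auto simp: op_function_def)
  then have "spectral_family_of (unitary_conj U L) (\<lambda>t. conj_op (E t))"
    "(x, y) \<in> stieltjes_op f (\<lambda>t. conj_op (E t))"
    by (simp_all add: spectral_family_of_conj_op stieltjes_op_conj_op)
  then show "(x, y) \<in> op_function f (unitary_conj U L)"
    by (auto simp: op_function_def)
qed

lemma op_function_unitary_conj: "op_function f (unitary_conj U L) = unitary_conj U (op_function f L)"
proof
  show "op_function f (unitary_conj U L) \<subseteq> unitary_conj U (op_function f L)"
    using unitary_pair.op_function_unitary_conj_subset [OF inverse_pair, of f "unitary_conj U L"]
    by (auto simp: unitary_pair.mem_unitary_conj [OF inverse_pair] subset_iff)
qed (rule op_function_unitary_conj_subset)


subsection \<open>Algebras with space extension\<close>

text \<open>The pair \<open>E\<close>, \<open>E'\<close> stays abstract, and the compatibility with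
  \<open>U\<close> is all that is assumed; the wave extensions are substituted at the end.\<close>

context
  fixes E :: "real \<Rightarrow> 'a set \<Rightarrow> 'a set" and E' :: "real \<Rightarrow> 'b set \<Rightarrow> 'b set"
  assumes equivariant: "\<forall>t A. E' t (U ` A) = U ` E t A"
begin

lemma extend_proj_conj_op: "extend_proj E' t (conj_op P) = conj_op (extend_proj E t P)"
  by (simp add: extend_proj_def range_conj_op equivariant proj_onto_image del: conj_op_apply)

text \<open>Conjugation maps every algebra admissible in the intersection defining
  \<open>ext_algebra E a\<close> to one admissible for \<open>E'\<close>, so \<open>S\<close> lies
  in all these images.\<close>

lemma ext_algebra_conj_op_subset: "ext_algebra E' ((`) U ` a) \<subseteq> conj_op ` ext_algebra E a"
proof
  fix S assume S: "S \<in> ext_algebra E' ((`) U ` a)"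
  have "S \<in> conj_op ` M"
    if M: "von_neumann_algebra M" "\<forall>A\<in>a. proj_onto A \<in> M"
      "\<forall>P \<in> M \<inter> projections. \<forall>t>0. extend_proj E t P \<in> M" for M
  proof -
    have "\<forall>A\<in>(`) U ` a. proj_onto A \<in> conj_op ` M"
      using M by (auto simp: proj_onto_image)
    moreover have "\<forall>P \<in> conj_op ` M \<inter> projections. \<forall>t>0. extend_proj E' t P \<in> conj_op ` M"
      using M by (auto simp: extend_proj_conj_op)
    ultimately show ?thesis
      using S von_neumann_algebra_image_conj_op [OF M(1)] unfolding ext_algebra_def by blast
  qed
  \<comment> \<open>The preimage of \<open>S\<close> is the same for all \<open>M\<close>, so it
    lies in their intersection.\<close>
  then have "unitary_pair.conj_op V U S \<in> ext_algebra E a"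
    unfolding ext_algebra_def by force
  then show "S \<in> conj_op ` ext_algebra E a"
    by (metis conj_op_inverse' image_eqI)
qed

end

text \<open>The converse is the inclusion for \<open>V\<close> with \<open>E\<close> and
  \<open>E'\<close> exchanged, conjugated back by \<open>U\<close>.\<close>

lemma ext_algebra_conj_op:
  assumes "\<forall>t A. E' t (U ` A) = U ` E t A"
  shows "ext_algebra E' ((`) U ` a) = conj_op ` ext_algebra E a"
proof
  have "E t (V ` B) = V ` E' t B" for t B
    using assms [rule_format, of t "V ` B"] by (simp add: image_image)
  then have "ext_algebra E ((`) V ` (`) U ` a) \<subseteq> unitary_pair.conj_op V U ` ext_algebra E' ((`) U ` a)"
    by (intro unitary_pair.ext_algebra_conj_op_subset [OF inverse_pair]) simp
  then have "conj_op ` ext_algebra E a \<subseteq> conj_op ` unitary_pair.conj_op V U ` ext_algebra E' ((`) U ` a)"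
    by (intro image_mono) (simp add: image_image)
  then show "conj_op ` ext_algebra E a \<subseteq> ext_algebra E' ((`) U ` a)"
    by (simp add: image_image)
qed (rule ext_algebra_conj_op_subset [OF assms])

context
  fixes E :: "real \<Rightarrow> 'a set \<Rightarrow> 'a set" and E' :: "real \<Rightarrow> 'b set \<Rightarrow> 'b set"
  assumes equivariant: "\<forall>t A. E' t (U ` A) = U ` E t A"
begin

lemma eikonal_op_conj_op: "eikonal_op E' (conj_op P) = unitary_conj U (eikonal_op E P)"
  by (simp add: eikonal_op_def extend_proj_conj_op [OF equivariant] stieltjes_op_conj_op)

lemma eikonal_op_conj_op_eq_iff:
  "eikonal_op E' (conj_op P) = op_graph (conj_op T) \<longleftrightarrow> eikonal_op E P = op_graph T"
  by (simp add: eikonal_op_conj_op op_graph_conj_op unitary_conj_eq_iff)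

lemma ext_algebra_projections_conj_op:
  "ext_algebra E' ((`) U ` a) \<inter> projections = conj_op ` (ext_algebra E a \<inter> projections)"
  by (auto simp: ext_algebra_conj_op [OF equivariant])

lemma bounded_case_conj_op:
  assumes "bounded_case E a"
  shows "bounded_case E' ((`) U ` a)"
proof -
  obtain C where C: "\<And>P. P \<in> ext_algebra E a \<inter> projections \<Longrightarrow>
      \<exists>T\<in>bounded_ops. eikonal_op E P = op_graph T \<and> norm T \<le> C"
    using assms unfolding bounded_case_def by blast
  \<comment> \<open>Conjugation preserves the operator norm, so the uniform bound \<open>C\<close>
    is kept.\<close>
  have "\<exists>T\<in>bounded_ops. eikonal_op E' (conj_op P) = op_graph T \<and> norm T \<le> C"
    if "P \<in> ext_algebra E a \<inter> projections" for P
    using C [OF that] by (metis bounded_ops_conj_op eikonal_op_conj_op_eq_iff norm_conj_op)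
  then show ?thesis
    unfolding bounded_case_def ext_algebra_projections_conj_op by blast
qed

text \<open>The sets before closure correspond because projections of the two algebras and their
  eikonals do; a homeomorphism of the strong topology then commutes with the closure.\<close>

lemma eikonals_conj_op: "eikonals E' ((`) U ` a) = conj_op ` eikonals E a"
proof -
  let ?X = "{T \<in> bounded_ops. \<exists>P \<in> ext_algebra E a \<inter> projections. eikonal_op E P = op_graph T}"
  have "S \<in> bounded_ops \<and> (\<exists>P \<in> ext_algebra E' ((`) U ` a) \<inter> projections.
      eikonal_op E' P = op_graph S) \<longleftrightarrow> S \<in> conj_op ` ?X" for S
  proof -
    obtain T where "S = conj_op T"
      by (metis conj_op_inverse')
    then show ?thesis
      unfolding ext_algebra_projections_conj_op by (simp add: eikonal_op_conj_op_eq_iff image_iff)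
  qed
  then have "eikonals E' ((`) U ` a) = strong_operator_topology closure_of (conj_op ` ?X)"
    unfolding eikonals_def by (simp only: Collect_mem_eq)
  also have "\<dots> = conj_op ` (strong_operator_topology closure_of ?X)"
    by (rule homeomorphic_map_closure_of [OF homeomorphic_map_conj_op])
      (simp add: strong_operator_topology_topspace)
  finally show ?thesis
    by (simp add: eikonals_def)
qed

text \<open>\<open>conj_op\<close> preserves and reflects \<open>op_le\<close>, hence both
  comparability and maximality.\<close>

lemma maximal_eikonals_conj_op: "maximal_eikonals E' ((`) U ` a) = conj_op ` maximal_eikonals E a"
  unfolding maximal_eikonals_def eikonals_conj_op by auto

end

end


section \<open>The wave spectrum\<close>

text \<open>Separability enters here because the Bochner integral in \<open>wave\<close> is defined
  for second countable spaces.\<close>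

locale separable_unitary_pair = unitary_pair U V
  for U :: "'a::{chilbert_space, second_countable_topology} \<Rightarrow>
      'b::{chilbert_space, second_countable_topology}" and V
begin

section \<open>Waves and the space extension\<close>

lemma inverse_separable_pair: "separable_unitary_pair V U"
  using inverse_pair by (simp add: separable_unitary_pair_def)

text \<open>Agreement of the controls is asked only on the interval of integration, since second
  derivatives of controls will be compared at nonnegative times only.\<close>

lemma wave_unitary_conj:
  assumes "\<And>s. 0 \<le> s \<Longrightarrow> s \<le> t \<Longrightarrow> k s = U (h s)"
  shows "wave (unitary_conj U L) k t = U (wave L h t)"
proof -
  let ?g = "\<lambda>s. op_apply (op_function (\<lambda>r. 1 / sqrt r) L)
       (op_apply (op_function (\<lambda>r. sin ((t - s) * sqrt r)) L) (h s))"
  have "wave (unitary_conj U L) k t = (LINT s:{0..t}|lborel. U (?g s))"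
    unfolding wave_def
    by (rule set_lebesgue_integral_cong)
      (auto simp: assms op_function_unitary_conj op_apply_unitary_conj)
  also have "\<dots> = (LINT s|lborel. U (indicator {0..t} s *\<^sub>R ?g s))"
    by (simp add: set_lebesgue_integral_def U_scaleR)
  also have "\<dots> = U (LINT s:{0..t}|lborel. ?g s)"
    unfolding set_lebesgue_integral_def
    \<comment> \<open>The bounded inverse \<open>V\<close> makes this valid for every integrand: if
      \<open>?g\<close> is not integrable, neither is its image, and both integrals are zero by
      convention.\<close>
    by (rule integral_bounded_linear' [OF bounded_linear_U bounded_linear_V]) simp
  finally show ?thesis
    by (simp add: wave_def)
qed

lemma L2_loc_image:
  assumes "h \<in> L2_loc A"
  shows "(\<lambda>t. U (h t)) \<in> L2_loc (U ` A)"
proof -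
  have "(\<lambda>t. indicator {0<..} t *\<^sub>R h t) \<in> borel_measurable lborel"
    using assms by (simp add: L2_loc_def set_borel_measurable_def)
  then have "(\<lambda>t. U (indicator {0<..} t *\<^sub>R h t)) \<in> borel_measurable lborel"
    by (rule measurable_compose)
      (rule borel_measurable_continuous_onI [OF linear_continuous_on [OF bounded_linear_U]])
  then show ?thesis
    using assms by (simp add: L2_loc_def set_borel_measurable_def U_scaleR)
qed

lemma wave_extension_unitary_conj:
  "wave_extension (unitary_conj U L) t (U ` A) = U ` wave_extension L t A"
proof -
  have "{wave (unitary_conj U L) h t | h. h \<in> L2_loc (U ` A)} = U ` {wave L h t | h. h \<in> L2_loc A}"
  proof (intro equalityI subsetI)
    fix y assume "y \<in> {wave (unitary_conj U L) h t | h. h \<in> L2_loc (U ` A)}"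
    then obtain h where h: "h \<in> L2_loc (U ` A)" and y: "y = wave (unitary_conj U L) h t"
      by blast
    have "(\<lambda>s. V (h s)) \<in> L2_loc A"
      using separable_unitary_pair.L2_loc_image [OF inverse_separable_pair h]
      by (simp add: image_image)
    moreover have "y = U (wave L (\<lambda>s. V (h s)) t)"
      unfolding y by (rule wave_unitary_conj) simp
    ultimately show "y \<in> U ` {wave L h t | h. h \<in> L2_loc A}"
      by blast
  next
    fix y assume "y \<in> U ` {wave L h t | h. h \<in> L2_loc A}"
    then obtain h where h: "h \<in> L2_loc A" and y: "y = U (wave L h t)"
      by blast
    have "y = wave (unitary_conj U L) (\<lambda>s. U (h s)) t"
      unfolding y by (rule wave_unitary_conj [symmetric]) simp
    with L2_loc_image [OF h] show "y \<in> {wave (unitary_conj U L) h t | h. h \<in> L2_loc (U ` A)}"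
      by blast
  qed
  then show ?thesis
    by (simp add: wave_extension_def closure_image_U)
qed

text \<open>Only nonnegative times are compared: for \<open>t < 0\<close> the value of \<^const>\<open>time_deriv\<close> is an arbitrary
  choice, which need not commute with \<open>U\<close>.\<close>

lemma time_deriv_transfer:
  assumes k: "\<And>s. 0 \<le> s \<Longrightarrow> k s = U (h s)"
    and h: "h differentiable (at t within {0..})" and t: "0 \<le> t"
  shows "k differentiable (at t within {0..})" "time_deriv k t = U (time_deriv h t)"
proof -
  have "(h has_vector_derivative time_deriv h t) (at t within {0..})"
    using h unfolding time_deriv_def by (simp add: vector_derivative_works)
  then have "((\<lambda>s. U (h s)) has_vector_derivative U (time_deriv h t)) (at t within {0..})"
    by (rule bounded_linear.has_vector_derivative [OF bounded_linear_U])
  then have D: "(k has_vector_derivative U (time_deriv h t)) (at t within {0..})"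
    by (rule has_vector_derivative_transform [rotated 2]) (use t k in auto)
  then show "k differentiable (at t within {0..})"
    by (rule differentiableI_vector)
  \<comment> \<open>The derivative is unique only at a limit point of the half-line; the points of
    \<open>{t<..<t+1}\<close> show that \<open>t\<close> is one, also for
    \<open>t = 0\<close>.\<close>
  have "at t within {0..} \<noteq> bot"
    using t islimpt_subset [OF islimpt_greaterThanLessThan1 [of t "t + 1"], of "{0..}"]
    by (simp add: trivial_limit_within subset_iff)
  then show "time_deriv k t = U (time_deriv h t)"
    unfolding time_deriv_def using D by (simp add: time_deriv_def vector_derivative_within)
qed

text \<open>Agreement of the derivatives of order \<open>n\<close> on the whole half-line is what
  \<open>time_deriv_transfer\<close> requires for order \<open>n + 1\<close>.\<close>

lemma funpow_time_deriv_transfer: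
  assumes h: "\<And>n t. 0 \<le> t \<Longrightarrow> (time_deriv ^^ n) h differentiable (at t within {0..})"
    and t: "0 \<le> t"
  shows "(time_deriv ^^ n) (\<lambda>s. U (h s)) t = U ((time_deriv ^^ n) h t)"
  using t
proof (induction n arbitrary: t)
  case (Suc n)
  have "time_deriv ((time_deriv ^^ n) (\<lambda>s. U (h s))) t = U (time_deriv ((time_deriv ^^ n) h) t)"
    by (rule time_deriv_transfer(2)) (use Suc h in auto)
  then show ?case
    by simp
qed simp

section \<open>Smooth controls and reachable sets\<close>

lemma smooth_controls_image:
  assumes "h \<in> smooth_controls D"
  shows "(\<lambda>t. U (h t)) \<in> smooth_controls (U ` D)"
proof -
  have h: "\<And>n t. 0 \<le> t \<Longrightarrow> (time_deriv ^^ n) h differentiable (at t within {0..})"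
    using assms by (simp add: smooth_controls_def)
  have "(time_deriv ^^ n) (\<lambda>s. U (h s)) differentiable (at t within {0..})" if "0 \<le> t" for n t
    by (rule time_deriv_transfer(1) [OF funpow_time_deriv_transfer [OF h] h]) (use that in auto)
  then show ?thesis
    using assms by (auto simp: smooth_controls_def intro: exI)
qed

lemma reachable_set_unitary_conj_subset:
  "U ` reachable_set L0 t \<subseteq> reachable_set (unitary_conj U L0) t"
proof
  fix y assume "y \<in> U ` reachable_set L0 t"
  then obtain h where h: "h \<in> smooth_controls (op_kernel (adjoint_op L0))"
    and y: "y = U (h t - wave (friedrichs_extension L0) (time_deriv (time_deriv h)) t)"
    unfolding reachable_set_def by blast
  \<comment> \<open>This is order two of \<open>funpow_time_deriv_transfer\<close>, in the form that
    \<open>wave_unitary_conj\<close> takes.\<close>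
  have "time_deriv (time_deriv (\<lambda>s. U (h s))) s = U (time_deriv (time_deriv h) s)" if "0 \<le> s" for s
    using funpow_time_deriv_transfer [of h s 2] h that
    by (simp add: smooth_controls_def numeral_2_eq_2)
  then have "y = U (h t) - wave (friedrichs_extension (unitary_conj U L0))
      (time_deriv (time_deriv (\<lambda>s. U (h s)))) t"
    unfolding y by (simp add: U_diff friedrichs_extension_unitary_conj wave_unitary_conj)
  moreover have "(\<lambda>s. U (h s)) \<in> smooth_controls (op_kernel (adjoint_op (unitary_conj U L0)))"
    using smooth_controls_image [OF h] by (simp add: adjoint_op_unitary_conj op_kernel_unitary_conj)
  ultimately show "y \<in> reachable_set (unitary_conj U L0) t"
    unfolding reachable_set_def by (intro CollectI exI [of _ "\<lambda>s. U (h s)"] conjI)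
qed

lemma reachable_set_unitary_conj: "reachable_set (unitary_conj U L0) t = U ` reachable_set L0 t"
proof
  have "V ` reachable_set (unitary_conj U L0) t \<subseteq> reachable_set L0 t"
    using separable_unitary_pair.reachable_set_unitary_conj_subset
      [OF inverse_separable_pair, of "unitary_conj U L0"] by simp
  then show "reachable_set (unitary_conj U L0) t \<subseteq> U ` reachable_set L0 t"
    by auto
qed (rule reachable_set_unitary_conj_subset)

section \<open>Isometry of the wave spectra\<close>

lemma reachable_family_unitary_conj:
  "reachable_family (unitary_conj U L0) = (`) U ` reachable_family L0"
  by (auto simp: reachable_family_def reachable_set_unitary_conj closure_image_U simp del: mem_image_U)

lemma wave_spectrum_defined_unitary_conj:
  "wave_spectrum_defined L0 \<Longrightarrow> wave_spectrum_defined (unitary_conj U L0)"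
  unfolding wave_spectrum_defined_def friedrichs_extension_unitary_conj reachable_family_unitary_conj
  by (erule bounded_case_conj_op [rotated]) (simp add: wave_extension_unitary_conj)

lemma wave_spectrum_unitary_conj: "wave_spectrum (unitary_conj U L0) = conj_op ` wave_spectrum L0"
  unfolding wave_spectrum_def friedrichs_extension_unitary_conj reachable_family_unitary_conj
  by (rule maximal_eikonals_conj_op) (simp add: wave_extension_unitary_conj)

lemma isometric_wave_spectrum: "isometric (wave_spectrum L0) (wave_spectrum (unitary_conj U L0))"
  unfolding isometric_def wave_spectrum_unitary_conj
  by (intro exI [of _ conj_op]) (simp add: bij_betw_def inj_on_def dist_conj_op)

end

text \<open>\<open>unitary\<close> demands surjectivity but not injectivity. The latter follows from
  preservation of distances, which makes \<open>inv U\<close> a two-sided inverse.\<close>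

lemma unitary_imp_separable_unitary_pair:
  fixes U :: "'a::{chilbert_space, second_countable_topology} \<Rightarrow>
      'b::{chilbert_space, second_countable_topology}"
  assumes "unitary U"
  shows "separable_unitary_pair U (inv U)"
proof
  have "norm (U x - U y) = norm (x - y)" for x y
  proof -
    have "U (x - y) = U x - U y"
    proof -
      have "U ((x - y) + y) = U (x - y) + U y"
        using assms unfolding unitary_def by blast
      then show ?thesis
        by (simp add: algebra_simps)
    qed
    moreover have "complex_of_real ((norm (U (x - y)))\<^sup>2) = complex_of_real ((norm (x - y))\<^sup>2)"
      using assms by (simp only: cinner_self [symmetric] unitary_def)
    then have "(norm (U (x - y)))\<^sup>2 = (norm (x - y))\<^sup>2"
      by (simp only: of_real_eq_iff)
    ultimately show ?thesis
      by simp
  qed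
  then have "inj U"
    by (metis injI norm_eq_zero right_minus_eq)
  then show "inv U (U x) = x" for x
    by simp
  show "U (inv U y) = y" for y
    using assms by (simp add: unitary_def surj_f_inv_f)
qed (rule assms)

theorem mainTheorem2:
  fixes L0 :: "('a::{chilbert_space, second_countable_topology} \<times> 'a) set"
    and U :: "'a \<Rightarrow> 'b::{chilbert_space, second_countable_topology}"
  assumes "linear_operator L0" and "closed L0" and "densely_defined L0" and "symmetric_op L0"
    and "positive_definite L0" and "nonzero_defect_indexes L0"
    and "wave_spectrum_defined L0"
    and "unitary U"
  shows "wave_spectrum_defined (unitary_conj U L0) \<and>
    isometric (wave_spectrum L0) (wave_spectrum (unitary_conj U L0))"
proof -
  interpret separable_unitary_pair U "inv U"
    by (rule unitary_imp_separable_unitary_pair [OF \<open>unitary U\<close>])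
  show ?thesis
    using wave_spectrum_defined_unitary_conj [OF \<open>wave_spectrum_defined L0\<close>]
      isometric_wave_spectrum by blast
qed

end
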